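(* Let $S=\{s_1,\dots,s_t\}$ with $t\ge 3$, $1<s_1<s_2<\dots<s_t$ integers and $\gcd(s_1,\dots,s_t)=1$, and let $\mathbb{S}=\langle S\rangle$ with Frobenius number $F(\mathbb{S})$. Then $S$ is greedy if and only if $S$ has no witness $k$ with $s_3+s_1+2\le k\le F(\mathbb{S})+s_t+s_{t-1}$.
   Context: $\langle S\rangle=\{\sum_i a_i s_i : a_i\in\mathbb{N}_0\}$; $F(\mathbb{S})$ is the largest integer not in $\mathbb{S}$. A representation of $k\in\langle S\rangle$ is a vector $(a_1,\dots,a_t)\in\mathbb{N}_0^t$ with $\sum_i a_i s_i=k$; its cost is $\sum_i a_i$; $\mathrm{MinCost}_S(k)$ is the minimum cost over all representations. The (generalized) greedy representation of $k\in\langle S\rangle$, $k>0$: set $r:=k$; for $i=t,\dots,1$ let $a_i$ be the largest integer $q\ge0$ with $r-qs_i\in\langle S\rangle$ and replace $r$ by $r-a_is_i$; $\mathrm{GreedyCost}_S(k)=\sum_i a_i$ (with $\mathrm{GreedyCost}_S(0)=0$). $S$ is greedy if $\mathrm{GreedyCost}_S(k)=\mathrm{MinCost}_S(k)$ for all $k\in\langle S\rangle$, $k>0$. A witness for $S$ is an integer $k>0$, $k\in\langle S\rangle$, such that for some generator $s_i<k$ with $k-s_i\in\langle S\rangle$ one has $\mathrm{GreedyCost}_S(k)>\mathrm{GreedyCost}_S(k-s_i)+1$. *)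

theory Defs
  imports Main
begin

text \<open>
  A generator system $s_1 < \dots < s_t$ is a function \<open>s\<close> together with its length \<open>t\<close>; only the
  values \<open>s i\<close> with \<open>1 \<le> i \<le> t\<close> are relevant. Coefficient vectors \<open>a\<close> are treated alike.
\<close>

definition lin_comb :: "(nat \<Rightarrow> nat) \<Rightarrow> nat \<Rightarrow> (nat \<Rightarrow> nat) \<Rightarrow> nat" where
  "lin_comb s t a = (\<Sum>i=1..t. a i * s i)"

definition semigroup_gen :: "(nat \<Rightarrow> nat) \<Rightarrow> nat \<Rightarrow> nat set" where
  "semigroup_gen s t = {lin_comb s t a | a. True}"

text \<open>
  The largest integer outside the semigroup; it exists if the generators are positive and coprime.
\<close>

definition frobenius :: "(nat \<Rightarrow> nat) \<Rightarrow> nat \<Rightarrow> int" where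
  "frobenius s t = (GREATEST z. z \<notin> int ` semigroup_gen s t)"

definition representation :: "(nat \<Rightarrow> nat) \<Rightarrow> nat \<Rightarrow> nat \<Rightarrow> (nat \<Rightarrow> nat) \<Rightarrow> bool" where
  "representation s t k a \<longleftrightarrow> lin_comb s t a = k"

definition cost :: "nat \<Rightarrow> (nat \<Rightarrow> nat) \<Rightarrow> nat" where
  "cost t a = (\<Sum>i=1..t. a i)"

definition min_cost :: "(nat \<Rightarrow> nat) \<Rightarrow> nat \<Rightarrow> nat \<Rightarrow> nat" where
  "min_cost s t k = (LEAST c. \<exists>a. representation s t k a \<and> cost t a = c)"

text \<open>
  The largest \<open>q\<close> such that \<open>r - q * s i\<close>, computed in the integers, lies in the semigroup; the
  conjunct \<open>q * s i \<le> r\<close> guards against truncated subtraction.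
\<close>

definition greedy_coeff :: "(nat \<Rightarrow> nat) \<Rightarrow> nat \<Rightarrow> nat \<Rightarrow> nat \<Rightarrow> nat" where
  "greedy_coeff s t i r =
     (GREATEST q. q * s i \<le> r \<and> r - q * s i \<in> semigroup_gen s t)"

text \<open>
  \<open>greedy_steps s t i r\<close> performs the steps for the indices \<open>i, i - 1, \<dots>, 1\<close> on the current
  remainder \<open>r\<close>. Membership is always tested in the semigroup of all \<open>t\<close> generators.
\<close>

primrec greedy_steps :: "(nat \<Rightarrow> nat) \<Rightarrow> nat \<Rightarrow> nat \<Rightarrow> nat \<Rightarrow> (nat \<Rightarrow> nat)" where
  "greedy_steps s t 0 r = (\<lambda>_. 0)"
| "greedy_steps s t (Suc i) r =
     (let q = greedy_coeff s t (Suc i) r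
      in (greedy_steps s t i (r - q * s (Suc i)))(Suc i := q))"

definition greedy_rep :: "(nat \<Rightarrow> nat) \<Rightarrow> nat \<Rightarrow> nat \<Rightarrow> (nat \<Rightarrow> nat)" where
  "greedy_rep s t k = greedy_steps s t t k"

definition greedy_cost :: "(nat \<Rightarrow> nat) \<Rightarrow> nat \<Rightarrow> nat \<Rightarrow> nat" where
  "greedy_cost s t k = (if k = 0 then 0 else cost t (greedy_rep s t k))"

definition greedy :: "(nat \<Rightarrow> nat) \<Rightarrow> nat \<Rightarrow> bool" where
  "greedy s t \<longleftrightarrow> (\<forall>k \<in> semigroup_gen s t. k > 0 \<longrightarrow> greedy_cost s t k = min_cost s t k)"

definition witness :: "(nat \<Rightarrow> nat) \<Rightarrow> nat \<Rightarrow> nat \<Rightarrow> bool" where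
  "witness s t k \<longleftrightarrow> k > 0 \<and> k \<in> semigroup_gen s t \<and>
     (\<exists>i \<in> {1..t}. s i < k \<and> k - s i \<in> semigroup_gen s t \<and>
        greedy_cost s t k > greedy_cost s t (k - s i) + 1)"

end

theory Submission
  imports Defs
begin

text \<open>
  Let \<open>k\<close> be the least element whose greedy cost exceeds its minimal cost, and let \<open>j\<close> be the
  largest index with \<open>k - s j\<close> in the semigroup. The greedy algorithm uses \<open>s j\<close>, and by
  minimality of \<open>k\<close> no optimal representation does, so all optimal representations live on the
  indices below \<open>j\<close>; moreover \<open>k\<close> is a witness. If \<open>k\<close> exceeded the upper bound, then \<open>j = t\<close>,
  and an optimal summand \<open>s i\<close> could be exchanged for \<open>s t\<close>, because \<open>k - s i - s t\<close> still lies
  in the semigroup. If \<open>k\<close> were below the lower bound, then either \<open>j \<le> 2\<close>, so that \<open>k\<close> would be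
  optimally a multiple of \<open>s 1\<close>, the worst possible cost, or \<open>k - s j < 2 * s 1\<close> would be zero or
  a generator, making the greedy cost at most 2.
\<close>

section \<open>Cofinite additive submonoids of the natural numbers\<close>

lemma mult_mem_submonoid:
  fixes A :: "nat set"
  assumes "0 \<in> A" and add: "\<And>x y. x \<in> A \<Longrightarrow> y \<in> A \<Longrightarrow> x + y \<in> A" and "x \<in> A"
  shows "n * x \<in> A"
  using assms by (induction n) auto

text \<open>The least positive difference \<open>d\<close> of two elements divides every element, by
  division with remainder, so \<open>d = 1\<close>. Two consecutive elements \<open>a\<close> and
  \<open>Suc a\<close> then generate everything from \<open>a * a\<close> on.\<close>

lemma submonoid_cofinite:
  fixes A :: "nat set"
  assumes zero: "0 \<in> A" and add: "\<And>x y. x \<in> A \<Longrightarrow> y \<in> A \<Longrightarrow> x + y \<in> A" and "Gcd A = 1"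
  shows "\<exists>N. \<forall>n\<ge>N. n \<in> A"
proof -
  have mult: "n * x \<in> A" if "x \<in> A" for n x
    by (rule mult_mem_submonoid[OF zero _ that]) (rule add)
  define P where "P d \<longleftrightarrow> d > 0 \<and> (\<exists>a\<in>A. a + d \<in> A)" for d
  define d where "d = (LEAST d. P d)"
  obtain x where "x \<in> A" "x > 0"
  proof (rule ccontr)
    assume "\<not> thesis"
    then have "A \<subseteq> {0}" using that by blast
    then have "Gcd A = 0" by (simp add: Gcd_0_iff)
    with \<open>Gcd A = 1\<close> show False by simp
  qed
  then have "P x" using zero by (auto simp: P_def intro!: bexI[of _ 0])
  then have "P d" unfolding d_def by (rule LeastI)
  then obtain a where a: "a \<in> A" "a + d \<in> A" and "d > 0" by (auto simp: P_def)
  have "d dvd x" if "x \<in> A" for x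
  proof (rule ccontr)
    assume "\<not> d dvd x"
    then have pos: "x mod d > 0" by (simp add: mod_greater_zero_iff_not_dvd)
    \<comment> \<open>A nonzero remainder \<open>x mod d\<close> is itself a difference of two
      elements, contradicting the choice of \<open>d\<close>.\<close>
    have "x div d * a + x \<in> A" using mult[OF a(1)] add that by blast
    moreover have "x div d * a + x = x div d * (a + d) + x mod d"
      by (simp add: algebra_simps)
    moreover have "x div d * (a + d) \<in> A" using mult[OF a(2)] .
    ultimately have "P (x mod d)" using pos by (auto simp: P_def)
    then have "d \<le> x mod d" unfolding d_def by (rule Least_le)
    with mod_less_divisor[OF \<open>d > 0\<close>, of x] show False by simp
  qed
  then have "d dvd Gcd A" by (rule Gcd_greatest)
  with \<open>Gcd A = 1\<close> have a1: "Suc a \<in> A" using a(2) by simp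
  have "n \<in> A" if "n \<ge> a * a" for n
  proof (cases "a = 0")
    case True
    then show ?thesis using mult[OF a1, of n] by simp
  next
    case False
    \<comment> \<open>Among the \<open>n div a\<close> copies of \<open>a\<close> there are enough
      to replace \<open>n mod a\<close> of them by \<open>Suc a\<close>.\<close>
    have "n mod a \<le> n div a"
    proof (rule order_trans)
      show "n mod a \<le> a" using False by (simp add: less_imp_le)
      show "a \<le> n div a" using div_le_mono[OF that, of a] False by simp
    qed
    then have "(n div a - n mod a) * a + n mod a * Suc a
        = n div a * a - n mod a * a + (n mod a * a + n mod a)"
      and "n mod a * a \<le> n div a * a"
      by (simp_all add: diff_mult_distrib)
    then have "n = (n div a - n mod a) * a + n mod a * Suc a"
      by simp
    then show ?thesis using mult[OF a(1)] mult[OF a1] add by metis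
  qed
  then show ?thesis by blast
qed

section \<open>Minimal and greedy costs\<close>

locale generator_system =
  fixes s :: "nat \<Rightarrow> nat" and t :: nat
  assumes pos: "i \<in> {1..t} \<Longrightarrow> 0 < s i"
begin

abbreviation "M \<equiv> semigroup_gen s t"

lemma mem_iff_representation: "k \<in> M \<longleftrightarrow> (\<exists>a. representation s t k a)"
  by (auto simp: semigroup_gen_def representation_def)

lemma zero_mem: "0 \<in> M"
  by (auto simp: semigroup_gen_def lin_comb_def intro!: exI[of _ "\<lambda>_. 0"])

lemma add_mem: "x \<in> M \<Longrightarrow> y \<in> M \<Longrightarrow> x + y \<in> M"
proof -
  assume "x \<in> M" "y \<in> M"
  then obtain a b where "x = lin_comb s t a" "y = lin_comb s t b"
    by (auto simp: semigroup_gen_def)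
  then have "x + y = lin_comb s t (\<lambda>i. a i + b i)"
    by (simp add: lin_comb_def sum.distrib algebra_simps)
  then show ?thesis by (auto simp: semigroup_gen_def)
qed

lemma lin_comb_upd:
  assumes "i \<in> {1..t}"
  shows "lin_comb s t (a(i := Suc (a i))) = lin_comb s t a + s i"
    and "cost t (a(i := Suc (a i))) = Suc (cost t a)"
proof -
  have *: "(\<Sum>l=1..t. f l) = f i + (\<Sum>l\<in>{1..t} - {i}. f l)" for f :: "nat \<Rightarrow> nat"
    using assms by (simp add: sum.remove)
  show "lin_comb s t (a(i := Suc (a i))) = lin_comb s t a + s i"
    by (simp add: lin_comb_def * del: One_nat_def)
  show "cost t (a(i := Suc (a i))) = Suc (cost t a)"
    by (simp add: cost_def * del: One_nat_def)
qed

lemma gen_mem: "i \<in> {1..t} \<Longrightarrow> s i \<in> M"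
  using lin_comb_upd(1)[of i "\<lambda>_. 0"]
  by (auto simp: semigroup_gen_def lin_comb_def intro: exI[of _ "(\<lambda>_. 0)(i := 1)"])

section \<open>Minimal costs and optimal representations\<close>

lemma min_cost_le: "representation s t k a \<Longrightarrow> min_cost s t k \<le> cost t a"
  unfolding min_cost_def by (rule Least_le) auto

lemma obtain_min_representation:
  assumes "k \<in> M"
  obtains a where "representation s t k a" "cost t a = min_cost s t k"
proof -
  have "\<exists>c a. representation s t k a \<and> cost t a = c"
    using assms by (auto simp: mem_iff_representation)
  then have "\<exists>a. representation s t k a \<and> cost t a = min_cost s t k"
    unfolding min_cost_def by (rule LeastI_ex)
  then show ?thesis using that by blast
qed

lemma min_cost_0: "min_cost s t 0 = 0"
  using min_cost_le[of 0 "\<lambda>_. 0"] by (simp add: representation_def lin_comb_def cost_def)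

lemma min_cost_add_gen:
  assumes "r \<in> M" "i \<in> {1..t}"
  shows "min_cost s t (r + s i) \<le> Suc (min_cost s t r)"
proof -
  obtain a where "representation s t r a" "cost t a = min_cost s t r"
    using obtain_min_representation assms by blast
  then show ?thesis
    using min_cost_le[of "r + s i" "a(i := Suc (a i))"] lin_comb_upd[of i a] assms
    by (simp add: representation_def)
qed

text \<open>Optimality passes to the remainder: a cheaper representation of \<open>r\<close> would
  give one of \<open>k\<close> by adding \<open>s i\<close> back.\<close>

lemma min_representation_step:
  assumes rep: "representation s t k a" "cost t a = min_cost s t k"
    and i: "i \<in> {1..t}" and "a i > 0"
  obtains r where "r \<in> M" "k = r + s i" "min_cost s t k = Suc (min_cost s t r)"
proof -
  define b where "b = a(i := a i - 1)"
  define r where "r = lin_comb s t b"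
  have "a = b(i := Suc (b i))" using \<open>a i > 0\<close> by (auto simp: b_def)
  then have k: "k = r + s i" and c: "cost t a = Suc (cost t b)"
    using lin_comb_upd[OF i, of b] rep by (simp_all add: representation_def r_def)
  have "r \<in> M" by (auto simp: r_def semigroup_gen_def)
  moreover have "min_cost s t r \<le> cost t b"
    by (intro min_cost_le) (simp add: representation_def r_def)
  ultimately show ?thesis
    using that[OF _ k] min_cost_add_gen[OF _ i, of r] rep c k by simp
qed

lemma representation_nonzero:
  assumes "representation s t k a" "k > 0"
  obtains i where "i \<in> {1..t}" "a i > 0"
proof -
  have "lin_comb s t a \<noteq> 0" using assms by (simp add: representation_def)
  then have "\<exists>i\<in>{1..t}. a i > 0"
    unfolding lin_comb_def by (auto simp: sum_eq_0_iff)
  then show ?thesis using that by blast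
qed

lemma min_cost_step:
  assumes "k \<in> M" "k > 0"
  obtains i r where "i \<in> {1..t}" "r \<in> M" "k = r + s i" "min_cost s t k = Suc (min_cost s t r)"
  using assms obtain_min_representation representation_nonzero min_representation_step
  by metis

lemma mult_min_cost_le:
  assumes "k \<in> M" and le: "\<And>i. i \<in> {1..t} \<Longrightarrow> m \<le> s i"
  shows "m * min_cost s t k \<le> k"
proof -
  obtain a where a: "representation s t k a" "cost t a = min_cost s t k"
    using obtain_min_representation assms by blast
  have "m * cost t a \<le> lin_comb s t a"
    unfolding cost_def lin_comb_def sum_distrib_left
    by (intro sum_mono) (simp add: le mult.commute)
  with a show ?thesis by (simp add: representation_def)
qed

section \<open>Coefficients chosen by the greedy algorithm\<close>

lemma greedy_coeff_props:
  assumes "r \<in> M" "i \<in> {1..t}"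
  shows "greedy_coeff s t i r * s i \<le> r"
    and "r - greedy_coeff s t i r * s i \<in> M"
    and "q * s i \<le> r \<Longrightarrow> r - q * s i \<in> M \<Longrightarrow> q \<le> greedy_coeff s t i r"
proof -
  let ?P = "\<lambda>q. q * s i \<le> r \<and> r - q * s i \<in> M"
  \<comment> \<open>Positivity of \<open>s i\<close> bounds the candidates, so the
    \<open>GREATEST\<close> in the definition is attained.\<close>
  have bound: "q \<le> r" if "?P q" for q
  proof -
    have "q * 1 \<le> q * s i" using pos[OF assms(2)] by (intro mult_le_mono2) simp
    with that show ?thesis by linarith
  qed
  have "?P 0" using assms by simp
  from GreatestI_nat[of ?P, OF this bound]
  show "greedy_coeff s t i r * s i \<le> r" "r - greedy_coeff s t i r * s i \<in> M"
    unfolding greedy_coeff_def by auto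
  show "q \<le> greedy_coeff s t i r" if "q * s i \<le> r" "r - q * s i \<in> M"
    unfolding greedy_coeff_def by (rule Greatest_le_nat[of ?P, OF _ bound]) (use that in auto)
qed

text \<open>From a coefficient \<open>Suc q\<close>, adding \<open>q\<close> copies of
  \<open>s i\<close> back to the remainder would show that \<open>r - s i\<close> lies in
  \<open>M\<close>.\<close>

lemma greedy_coeff_0:
  assumes "r \<in> M" "i \<in> {1..t}" and no: "\<And>x. x \<in> M \<Longrightarrow> r \<noteq> x + s i"
  shows "greedy_coeff s t i r = 0"
proof (rule ccontr)
  assume "greedy_coeff s t i r \<noteq> 0"
  then obtain q where q: "greedy_coeff s t i r = Suc q" using not0_implies_Suc by blast
  let ?y = "r - Suc q * s i"
  have "Suc q * s i \<le> r" "?y \<in> M"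
    using greedy_coeff_props(1,2)[OF assms(1,2)] by (simp_all only: q)
  moreover have "q * s i \<in> M"
    using mult_mem_submonoid[OF zero_mem add_mem gen_mem[OF assms(2)]] .
  ultimately have "?y + q * s i \<in> M" "r = (?y + q * s i) + s i"
    using add_mem by (blast, simp)
  with no show False by blast
qed

text \<open>The positive candidates for \<open>x + s i\<close> are exactly the successors of the
  candidates for \<open>x\<close>.\<close>

lemma greedy_coeff_add:
  assumes "x \<in> M" "i \<in> {1..t}"
  shows "greedy_coeff s t i (x + s i) = Suc (greedy_coeff s t i x)"
proof (rule antisym)
  have r: "x + s i \<in> M" using assms add_mem gen_mem by blast
  note x = greedy_coeff_props[OF assms] and xs = greedy_coeff_props[OF r assms(2)]
  show "Suc (greedy_coeff s t i x) \<le> greedy_coeff s t i (x + s i)"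
    by (rule xs(3)) (use x in \<open>simp_all add: add.commute\<close>)
  show "greedy_coeff s t i (x + s i) \<le> Suc (greedy_coeff s t i x)"
  proof (cases "greedy_coeff s t i (x + s i)")
    case (Suc q)
    have "q \<le> greedy_coeff s t i x"
      by (rule x(3)) (use xs(1,2) in \<open>simp_all add: Suc add.commute\<close>)
    then show ?thesis using Suc by simp
  qed simp
qed

section \<open>Recursion for the greedy cost\<close>

definition steps_cost :: "nat \<Rightarrow> nat \<Rightarrow> nat" where
  "steps_cost i r = cost i (greedy_steps s t i r)"

text \<open>As \<open>cost i\<close> reads no coefficient above \<open>i\<close>, the update at
  \<open>Suc i\<close> leaves the cost of the remaining steps intact.\<close>

lemma steps_cost_simps [simp]:
  "steps_cost 0 r = 0"
  "steps_cost (Suc i) r = greedy_coeff s t (Suc i) r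
     + steps_cost i (r - greedy_coeff s t (Suc i) r * s (Suc i))"
  by (simp_all add: steps_cost_def cost_def Let_def)

lemma steps_cost_skip:
  assumes "r \<in> M" "j \<le> i" "i \<le> t" and no: "\<And>l x. j < l \<Longrightarrow> l \<le> i \<Longrightarrow> x \<in> M \<Longrightarrow> r \<noteq> x + s l"
  shows "steps_cost i r = steps_cost j r"
  using assms(2,3) no
proof (induction i rule: dec_induct)
  case base
  then show ?case by simp
next
  case (step i)
  then have "greedy_coeff s t (Suc i) r = 0"
    by (intro greedy_coeff_0 assms(1)) auto
  then show ?case using step by simp
qed

lemma greedy_cost_0: "greedy_cost s t 0 = 0"
  by (simp add: greedy_cost_def)

text \<open>No positive generator can be taken from 0, so the separate case \<open>k = 0\<close> in
  \<open>greedy_cost\<close> agrees with the algorithm.\<close>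

lemma steps_cost_0: "steps_cost t 0 = 0"
proof -
  have "steps_cost t 0 = steps_cost 0 0"
    by (rule steps_cost_skip[OF zero_mem]) (use pos in \<open>force simp: Suc_le_eq\<close>)+
  then show ?thesis by simp
qed

lemma greedy_cost_eq_steps_cost: "greedy_cost s t k = steps_cost t k"
  using steps_cost_0 by (simp add: greedy_cost_def steps_cost_def greedy_rep_def)

text \<open>The runs on \<open>x\<close> and on \<open>x + s j\<close> both idle above index
  \<open>j\<close>; there the coefficients differ by one, and the remainders coincide
  afterwards.\<close>

lemma greedy_cost_add:
  assumes "x \<in> M" "j \<in> {1..t}"
    and no: "\<And>l y. j < l \<Longrightarrow> l \<le> t \<Longrightarrow> y \<in> M \<Longrightarrow> x + s j \<noteq> y + s l"
  shows "greedy_cost s t (x + s j) = Suc (greedy_cost s t x)"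
proof -
  obtain i where i: "j = Suc i" using assms(2) by (cases j) auto
  have r: "x + s j \<in> M" using assms add_mem gen_mem by blast
  \<comment> \<open>If \<open>s l\<close> could be taken from \<open>x\<close>, it could also be
    taken from \<open>x + s j\<close>.\<close>
  have "x \<noteq> y + s l" if "j < l" "l \<le> t" "y \<in> M" for l y
    using no[OF that(1,2), of "y + s j"] add_mem gen_mem that assms(2) by fastforce
  then have "steps_cost t x = steps_cost j x"
    using assms by (intro steps_cost_skip) auto
  moreover have "steps_cost t (x + s j) = steps_cost j (x + s j)"
    using assms r by (intro steps_cost_skip) auto
  moreover have "steps_cost j (x + s j) = Suc (steps_cost j x)"
    using greedy_coeff_add[OF assms(1,2)] by (simp add: i)
  ultimately show ?thesis by (simp add: greedy_cost_eq_steps_cost)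
qed

text \<open>Here \<open>j\<close> is the largest index whose generator can be removed from
  \<open>k\<close>. This recursion replaces the algorithm in all later arguments.\<close>

lemma greedy_cost_step:
  assumes "k \<in> M" "k > 0"
  obtains j x where "j \<in> {1..t}" "x \<in> M" "k = x + s j"
    "greedy_cost s t k = Suc (greedy_cost s t x)"
    "\<forall>l y. j < l \<longrightarrow> l \<le> t \<longrightarrow> y \<in> M \<longrightarrow> k \<noteq> y + s l"
proof -
  define J where "J = {j \<in> {1..t}. \<exists>x\<in>M. k = x + s j}"
  have "finite J" by (simp add: J_def)
  obtain i r where "i \<in> {1..t}" "r \<in> M" "k = r + s i" "min_cost s t k = Suc (min_cost s t r)"
    by (rule min_cost_step[OF assms])
  then have "J \<noteq> {}" by (auto simp: J_def)
  have "Max J \<in> J" using Max_in \<open>finite J\<close> \<open>J \<noteq> {}\<close> by blast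
  then obtain x where x: "x \<in> M" "k = x + s (Max J)" "Max J \<in> {1..t}" by (auto simp: J_def)
  have no: "k \<noteq> y + s l" if "Max J < l" "l \<le> t" "y \<in> M" for l y
  proof
    assume "k = y + s l"
    then have "l \<in> J" using that by (auto simp: J_def)
    then show False using Max_ge[OF \<open>finite J\<close>] that(1) by fastforce
  qed
  show ?thesis
    using that[OF x(3,1,2)] greedy_cost_add[OF x(1,3)] no x(2) by metis
qed

lemma min_cost_le_greedy_cost: "k \<in> M \<Longrightarrow> min_cost s t k \<le> greedy_cost s t k"
proof (induction k rule: less_induct)
  case (less k)
  show ?case
  proof (cases "k = 0")
    case True
    then show ?thesis by (simp add: min_cost_0)
  next
    case False
    then obtain j x where j: "j \<in> {1..t}" "x \<in> M" "k = x + s j"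
      "greedy_cost s t k = Suc (greedy_cost s t x)"
      using greedy_cost_step[OF less.prems] by (metis gr0I)
    then have "min_cost s t x \<le> greedy_cost s t x" using pos by (intro less.IH) auto
    then show ?thesis using min_cost_add_gen[OF j(2,1)] j by simp
  qed
qed

section \<open>Witnesses and failures of greediness\<close>

lemma greedy_imp_no_witness:
  assumes "greedy s t"
  shows "\<not> witness s t k"
proof
  assume "witness s t k"
  then obtain i where i: "k > 0" "k \<in> M" "i \<in> {1..t}" "s i < k" "k - s i \<in> M"
    "greedy_cost s t k > greedy_cost s t (k - s i) + 1"
    by (auto simp: witness_def)
  \<comment> \<open>\<open>greedy\<close> speaks of positive elements only; \<open>s i < k\<close>
    makes it applicable to \<open>k - s i\<close>.\<close>
  then have "min_cost s t k > min_cost s t (k - s i) + 1"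
    using assms by (auto simp: greedy_def)
  then show False using min_cost_add_gen[OF i(5,3)] i(4) by simp
qed

lemma not_greedy_least:
  assumes "\<not> greedy s t"
  obtains k where "k \<in> M" "k > 0" "min_cost s t k < greedy_cost s t k"
    "\<forall>r. r \<in> M \<longrightarrow> r < k \<longrightarrow> greedy_cost s t r = min_cost s t r"
proof -
  let ?P = "\<lambda>k. k \<in> M \<and> greedy_cost s t k \<noteq> min_cost s t k"
  have "\<exists>k. ?P k" using assms by (auto simp: greedy_def)
  then obtain k where k: "?P k" "\<And>r. r < k \<Longrightarrow> \<not> ?P r"
    using exists_least_iff[of ?P] by blast
  have "k > 0" using k(1) min_cost_0 greedy_cost_0 by (cases k) auto
  then show ?thesis
    using that[of k] k min_cost_le_greedy_cost[of k] by fastforce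
qed

end

section \<open>Location of the least counterexample\<close>

locale least_counterexample = generator_system +
  fixes k :: nat
  assumes strict: "strict_mono_on {1..t} s"
    and k: "k \<in> semigroup_gen s t" "k > 0" "min_cost s t k < greedy_cost s t k"
    and below: "\<And>r. r \<in> semigroup_gen s t \<Longrightarrow> r < k \<Longrightarrow> greedy_cost s t r = min_cost s t r"
begin

lemma gen_le: "i \<in> {1..t} \<Longrightarrow> l \<in> {1..t} \<Longrightarrow> i \<le> l \<Longrightarrow> s i \<le> s l"
  using strict by (metis strict_mono_on_less_eq)

text \<open>If some optimal summand \<open>s i\<close> had \<open>i \<ge> j\<close>, maximality of
  \<open>j\<close> would force \<open>i = j\<close>, hence \<open>y = x\<close>, and the greedy cost
  of \<open>k\<close> would be minimal.\<close>

lemma greedy_index: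
  obtains j x where "j \<in> {1..t}" "x \<in> M" "k = x + s j"
    "greedy_cost s t k = Suc (min_cost s t x)"
    "\<forall>i y. i \<in> {1..t} \<longrightarrow> y \<in> M \<longrightarrow> k = y + s i \<longrightarrow>
      min_cost s t k = Suc (min_cost s t y) \<longrightarrow> i < j"
proof -
  obtain j x where j: "j \<in> {1..t}" "x \<in> M" "k = x + s j"
    "greedy_cost s t k = Suc (greedy_cost s t x)"
    and max: "\<forall>l y. j < l \<longrightarrow> l \<le> t \<longrightarrow> y \<in> M \<longrightarrow> k \<noteq> y + s l"
    by (rule greedy_cost_step[OF k(1,2)])
  have g: "greedy_cost s t k = Suc (min_cost s t x)"
    using j below[of x] pos by simp
  have "i < j" if i: "i \<in> {1..t}" "y \<in> M" "k = y + s i" "min_cost s t k = Suc (min_cost s t y)"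
    for i y
  proof (rule ccontr)
    assume "\<not> i < j"
    then have "i = j" using max i by (metis atLeastAtMost_iff linorder_neqE_nat)
    then show False using i j g k(3) by simp
  qed
  with that[OF j(1-3) g] show ?thesis by blast
qed

text \<open>For \<open>k = s i\<close> the single summand is optimal, so \<open>i < j\<close> and
  \<open>s i < s j\<close>; but \<open>s j\<close> is at most \<open>k\<close>.\<close>

lemma gen_neq: "i \<in> {1..t} \<Longrightarrow> k \<noteq> s i"
proof
  assume i: "i \<in> {1..t}" "k = s i"
  obtain j x where j: "j \<in> {1..t}" "x \<in> M" "k = x + s j"
    "greedy_cost s t k = Suc (min_cost s t x)"
    "\<forall>i y. i \<in> {1..t} \<longrightarrow> y \<in> M \<longrightarrow> k = y + s i \<longrightarrow>
      min_cost s t k = Suc (min_cost s t y) \<longrightarrow> i < j"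
    by (rule greedy_index)
  have "min_cost s t k \<le> 1"
    using min_cost_add_gen[OF zero_mem i(1)] i(2) by (simp add: min_cost_0)
  moreover obtain l r where "l \<in> {1..t}" "r \<in> M" "k = r + s l"
    "min_cost s t k = Suc (min_cost s t r)"
    by (rule min_cost_step[OF k(1,2)])
  ultimately have "min_cost s t k = Suc (min_cost s t 0)" by (simp add: min_cost_0)
  then have "i < j" using j(5) i zero_mem by simp
  then have "s i < s j" using strict i(1) j(1) by (simp add: strict_mono_onD)
  with i(2) j(3) show False by simp
qed

text \<open>Removing an optimal summand lowers the minimal cost by one, and the remainder is below
  \<open>k\<close>, where both costs agree; \<open>gen_neq\<close> supplies
  \<open>s i < k\<close>.\<close>

lemma is_witness: "witness s t k"
proof -
  obtain i r where i: "i \<in> {1..t}" "r \<in> M" "k = r + s i"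
    "min_cost s t k = Suc (min_cost s t r)"
    by (rule min_cost_step[OF k(1,2)])
  have "r > 0" using gen_neq[OF i(1)] i(3) by (cases r) auto
  moreover have "greedy_cost s t r = min_cost s t r" using i pos by (intro below) auto
  ultimately show ?thesis
    unfolding witness_def using k i by (auto intro!: bexI[of _ i])
qed

lemma upper_bound:
  assumes "t \<ge> 1" and large: "\<And>n. int n > F \<Longrightarrow> n \<in> M" and "F \<ge> 0"
  shows "int k \<le> F + int (s t) + int (s (t - 1))"
proof (rule ccontr)
  assume gt: "\<not> ?thesis"
  have t: "t \<in> {1..t}" using \<open>t \<ge> 1\<close> by simp
  obtain i r where i: "i \<in> {1..t}" "r \<in> M" "k = r + s i"
    "min_cost s t k = Suc (min_cost s t r)"
    by (rule min_cost_step[OF k(1,2)])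
  \<comment> \<open>No index exceeds \<open>t\<close>, so the side condition of
    \<open>greedy_cost_add\<close> is vacuous.\<close>
  have greedy_t: "greedy_cost s t (x + s t) = Suc (greedy_cost s t x)" if "x \<in> M" for x
    using that t by (intro greedy_cost_add) auto
  show False
  proof (cases "i = t")
    case True
    then have "greedy_cost s t k = Suc (greedy_cost s t r)" using greedy_t i by simp
    also have "greedy_cost s t r = min_cost s t r" using i pos by (intro below) auto
    finally show False using i k(3) by simp
  next
    case False
    then have "i \<le> t - 1" "t - 1 \<in> {1..t}" using i(1) by auto
    then have "s i \<le> s (t - 1)" using gen_le i(1) by simp
    \<comment> \<open>Since \<open>s i \<le> s (t - 1)\<close>, the assumed failure of the bound
      puts \<open>y\<close> above \<open>F\<close>; with \<open>F \<ge> 0\<close> the truncated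
      subtractions are exact.\<close>
    define y where "y = k - s t - s i"
    have y: "y \<in> M" "k = y + s i + s t"
    proof -
      show "k = y + s i + s t" using gt \<open>s i \<le> s (t - 1)\<close> \<open>F \<ge> 0\<close> by (simp add: y_def)
      then show "y \<in> M" using gt \<open>s i \<le> s (t - 1)\<close> by (intro large) simp
    qed
    have yi: "y + s i \<in> M" using y(1) i(1) add_mem gen_mem by blast
    \<comment> \<open>The chain exchanges \<open>s i\<close> for \<open>s t\<close> and ends with
      the greedy cost of \<open>k\<close> being at most \<open>Suc (min_cost s t r)\<close>, the
      minimal cost of \<open>k\<close>.\<close>
    have "greedy_cost s t k = Suc (greedy_cost s t (y + s i))" using greedy_t yi y(2) by simp
    also have "greedy_cost s t (y + s i) = min_cost s t (y + s i)"
      using yi y(2) pos[OF t] by (intro below) auto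
    also have "\<dots> \<le> Suc (min_cost s t y)" using min_cost_add_gen y(1) i(1) by blast
    also have "min_cost s t y = greedy_cost s t y"
      using y pos[OF t] by (intro below[symmetric]) auto
    also have "Suc (greedy_cost s t y) = greedy_cost s t (y + s t)" using greedy_t y(1) by simp
    also have "y + s t = r" using y(2) i(3) by simp
    also have "greedy_cost s t r = min_cost s t r" using i pos by (intro below) auto
    finally show False using i(4) k(3) by simp
  qed
qed

lemma lower_bound:
  assumes "t \<ge> 3" and "1 < s 1"
  shows "s 3 + s 1 + 2 \<le> k"
proof (rule ccontr)
  assume less: "\<not> ?thesis"
  obtain j x where j: "j \<in> {1..t}" "x \<in> M" "k = x + s j"
    "greedy_cost s t k = Suc (min_cost s t x)"
    and ij: "\<forall>i y. i \<in> {1..t} \<longrightarrow> y \<in> M \<longrightarrow> k = y + s i \<longrightarrow>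
      min_cost s t k = Suc (min_cost s t y) \<longrightarrow> i < j"
    by (rule greedy_index)
  have s1: "s 1 \<le> s i" if "i \<in> {1..t}" for i using gen_le[of 1 i] that by simp
  note cost_le = mult_min_cost_le[OF _ s1]
  show False
  proof (cases "j \<le> 2")
    case True
    obtain a where a: "representation s t k a" "cost t a = min_cost s t k"
      using obtain_min_representation k(1) by blast
    \<comment> \<open>Optimal indices lie below \<open>j \<le> 2\<close>, so only \<open>s 1\<close>
      can occur.\<close>
    have zero: "a i = 0" if i: "i \<in> {1..t} - {1}" for i
    proof (rule ccontr)
      assume "a i \<noteq> 0"
      obtain r where "r \<in> M" "k = r + s i" "min_cost s t k = Suc (min_cost s t r)"
        by (rule min_representation_step[OF a, of i]) (use i \<open>a i \<noteq> 0\<close> in auto)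
      then have "i < j" using ij i by blast
      with True i show False by auto
    qed
    have "k = a 1 * s 1" "min_cost s t k = a 1"
      using a zero \<open>t \<ge> 3\<close>
      by (simp_all add: representation_def lin_comb_def cost_def sum.remove[of _ 1] del: One_nat_def)
    then have "k = s 1 * min_cost s t k" by simp
    \<comment> \<open>As \<open>s 1\<close> is the least generator, no minimal cost plus one, and
      hence not the greedy cost, can exceed \<open>k\<close> divided by \<open>s 1\<close>.\<close>
    moreover have "s 1 * Suc (min_cost s t x) \<le> k"
      using cost_le[OF j(2)] s1[OF j(1)] j(3) by simp
    ultimately have "Suc (min_cost s t x) \<le> min_cost s t k"
      using \<open>1 < s 1\<close> by (metis mult_le_cancel1 not_one_less_zero gr0I)
    then show False using j(4) k(3) by simp
  next
    case False
    then have "s 3 \<le> s j" using gen_le[of 3 j] j(1) by simp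
    \<comment> \<open>The constant 2 in the bound is absorbed by \<open>s 1 \<ge> 2\<close>.\<close>
    then have "x < s 1 * 2" using less j(3) \<open>1 < s 1\<close> by simp
    then have "s 1 * min_cost s t x < s 1 * 2" using cost_le[OF j(2)] by (rule le_less_trans[rotated])
    then have "min_cost s t x < 2" by simp
    \<comment> \<open>The greedy cost is at most 2 and not minimal, so \<open>k\<close> would have
      to be a single generator, against \<open>gen_neq\<close>.\<close>
    then have "min_cost s t k \<le> 1" using j(4) k(3) by simp
    moreover obtain i r where i: "i \<in> {1..t}" "r \<in> M" "k = r + s i"
      "min_cost s t k = Suc (min_cost s t r)"
      by (rule min_cost_step[OF k(1,2)])
    ultimately have "min_cost s t r = 0" by simp
    have "r = 0"
    proof (rule ccontr)
      assume "r \<noteq> 0"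
      then show False using min_cost_step[of r] i(2) \<open>min_cost s t r = 0\<close> by auto
    qed
    then show False using gen_neq[OF i(1)] i(3) by simp
  qed
qed

end

section \<open>Existence and sign of the Frobenius number\<close>

context generator_system
begin

text \<open>The gaps form a finite set by cofiniteness, and 1 is among them; their maximum is the
  Frobenius number.\<close>

lemma frobenius_props:
  assumes "Gcd (s ` {1..t}) = 1" "1 \<notin> M"
  shows "int n > frobenius s t \<Longrightarrow> n \<in> M" and "frobenius s t \<ge> 0"
proof -
  have "Gcd M dvd Gcd (s ` {1..t})"
    using gen_mem by (intro Gcd_greatest) (auto simp del: One_nat_def intro!: Gcd_dvd)
  then have "Gcd M = 1" using assms(1) by simp
  then obtain N where N: "\<And>n. n \<ge> N \<Longrightarrow> n \<in> M"
    using submonoid_cofinite[OF zero_mem add_mem] by blast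
  let ?P = "\<lambda>z. z \<notin> int ` M"
  let ?G = "{n. n \<notin> M}"
  have "finite ?G" using N by (intro finite_subset[of ?G "{..<N}"]) (auto simp: not_le[symmetric])
  have "Max ?G \<in> ?G" using assms(2) by (intro Max_in \<open>finite ?G\<close>) blast
  then have "?P (int (Max ?G))" by auto
  moreover have ub: "z \<le> int (Max ?G)" if "?P z" for z
  proof (cases "z \<ge> 0")
    case True
    then have "nat z \<in> ?G" using that by (metis image_eqI mem_Collect_eq nat_0_le)
    then show ?thesis using Max_ge[OF \<open>finite ?G\<close>] True by fastforce
  qed simp
  ultimately have F: "frobenius s t = int (Max ?G)"
    unfolding frobenius_def by (rule Greatest_equality)
  show "frobenius s t \<ge> 0" by (simp add: F)
  show "n \<in> M" if "int n > frobenius s t" using that Max_ge[OF \<open>finite ?G\<close>, of n] F by (auto simp: not_le[symmetric])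
qed

end

theorem theorem2:
  fixes s :: "nat \<Rightarrow> nat" and t :: nat
  assumes "t \<ge> 3"
    and "1 < s 1"
    and "strict_mono_on {1..t} s"
    and "Gcd (s ` {1..t}) = 1"
  shows "greedy s t \<longleftrightarrow>
    \<not> (\<exists>k. witness s t k \<and> s 3 + s 1 + 2 \<le> k \<and>
          int k \<le> frobenius s t + int (s t) + int (s (t - 1)))"
proof -
  have gt1: "1 < s i" if "i \<in> {1..t}" for i
    using strict_mono_on_leD[OF assms(3), of 1 i] assms(2) that by auto
  interpret generator_system s t
    by unfold_locales (use gt1 in force)
  \<comment> \<open>This gap ensures a nonnegative Frobenius number, as \<open>upper_bound\<close>
    requires.\<close>
  have one: "1 \<notin> semigroup_gen s t"
  proof
    assume "1 \<in> semigroup_gen s t"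
    then obtain i r where "i \<in> {1..t}" "1 = r + s i"
      by (rule min_cost_step) simp_all
    with gt1[of i] show False by simp
  qed
  show ?thesis (is "_ \<longleftrightarrow> \<not> ?W")
  proof (intro iffI)
    assume "greedy s t"
    then show "\<not> ?W" using greedy_imp_no_witness by blast
  next
    assume no: "\<not> ?W"
    show "greedy s t"
    proof (rule ccontr)
      assume "\<not> greedy s t"
      then obtain k where "k \<in> semigroup_gen s t" "k > 0" "min_cost s t k < greedy_cost s t k"
        "\<forall>r. r \<in> semigroup_gen s t \<longrightarrow> r < k \<longrightarrow> greedy_cost s t r = min_cost s t r"
        by (rule not_greedy_least)
      then interpret least_counterexample s t k
        using assms(3) by unfold_locales auto
      have "?W"
        using is_witness lower_bound[OF assms(1,2)] upper_bound[OF _ frobenius_props[OF assms(4) one]]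
          assms(1) by auto
      with no show False by blast
    qed
  qed
qed

end
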